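(* Let $0<p_T<1$ and let $\pi$ be a prior density for the inclusion probability $p$ which is continuous and nonzero on $(0,1)$. For $m\to\infty$, suppose the true model size $k_T=k_T(m)$ satisfies $k_T/m=p_T+O(1/\sqrt m)$. Consider models $M_\gamma$ (for each $m$, with $\gamma\in\{0,1\}^m$ of size $k_\gamma$) such that $k_T-k_\gamma=O(\sqrt m)$, and suppose the empirical-Bayes estimate $\hat p=\hat p_m\in[0,1]$ of $p_T$ satisfies $\hat p=p_T(1+\varepsilon_E)$ with $\varepsilon_E=O(1/\sqrt m)$ as $m\to\infty$. Then the ratio of the prior probabilities assigned to such models by the fully Bayes approach and the empirical-Bayes approach satisfies, as $m\to\infty$, $$\frac{p_F(M_\gamma)}{p_E(M_\gamma)}=\frac{\left(\frac{k_\gamma}{m}\right)^{k_\gamma}\left(1-\frac{k_\gamma}{m}\right)^{m-k_\gamma}\left[2\pi_0\,\frac{k_\gamma}{m}\left(1-\frac{k_\gamma}{m}\right)\right]^{1/2}\pi\!\left(\frac{k_\gamma}{m}\right)m^{-1/2}\{1+o(1)\}}{\hat p^{\,k_\gamma}(1-\hat p)^{m-k_\gamma}}=O\!\left(\frac{1}{\sqrt m}\right),$$ where $\pi_0=3.14159\ldots$ denotes the circle constant (to distinguish it from the prior density $\pi$).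
   Context: Models are indexed by binary vectors $\gamma\in\{0,1\}^m$, and $k_\gamma=\sum_{i=1}^m\gamma_i$ is the size of the model. Given a prior inclusion probability $p$, $p(M_\gamma\mid p)=p^{k_\gamma}(1-p)^{m-k_\gamma}$. The fully Bayes prior probability of a model under the prior density $\pi$ on $[0,1]$ is $p_F(M_\gamma)=\int_0^1p^{k_\gamma}(1-p)^{m-k_\gamma}\pi(p)\,dp$. The empirical-Bayes prior probability is $p_E(M_\gamma)=\hat p^{\,k_\gamma}(1-\hat p)^{m-k_\gamma}$, where $\hat p$ is the value of the empirical-Bayes estimate of the true prior inclusion probability $p_T$; the density $\pi$ and the number $p_T$ do not depend on $m$. *)

theory Defs
  imports "HOL-Analysis.Analysis" "HOL-Library.Landau_Symbols"
begin

text \<open>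
  Binary vectors \<open>\<gamma> = (\<gamma>\<^sub>1, \<dots>, \<gamma>\<^sub>m)\<close> with entries in \<open>{0, 1}\<close>, indexed by \<open>{1..m}\<close>.
\<close>
definition models :: "nat \<Rightarrow> (nat \<Rightarrow> nat) set" where
  "models m = {1..m} \<rightarrow>\<^sub>E {0, 1}"

definition model_size :: "nat \<Rightarrow> (nat \<Rightarrow> nat) \<Rightarrow> nat" where
  "model_size m \<gamma> = (\<Sum>i = 1..m. \<gamma> i)"

text \<open>
  For \<open>\<gamma> \<in> models m\<close> we have \<open>model_size m \<gamma> \<le> m\<close>, so the subtraction of natural
  numbers in the second exponent does not truncate.
\<close>
definition prior_given :: "nat \<Rightarrow> real \<Rightarrow> (nat \<Rightarrow> nat) \<Rightarrow> real" where
  "prior_given m p \<gamma> = p ^ model_size m \<gamma> * (1 - p) ^ (m - model_size m \<gamma>)"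

definition fully_bayes_prior :: "(real \<Rightarrow> real) \<Rightarrow> nat \<Rightarrow> (nat \<Rightarrow> nat) \<Rightarrow> real" where
  "fully_bayes_prior \<pi> m \<gamma> = (LINT p:{0..1}|lborel. prior_given m p \<gamma> * \<pi> p)"

definition emp_bayes_prior :: "real \<Rightarrow> nat \<Rightarrow> (nat \<Rightarrow> nat) \<Rightarrow> real" where
  "emp_bayes_prior p_hat m \<gamma> = prior_given m p_hat \<gamma>"

text \<open>
  Only the restriction of \<open>\<pi>\<close> to \<open>[0, 1]\<close> matters. An integrable singularity at \<open>0\<close> or \<open>1\<close>
  is allowed: the value of \<open>\<pi>\<close> at an endpoint can be any nonnegative real number.
\<close>
definition density_on_unit_interval :: "(real \<Rightarrow> real) \<Rightarrow> bool" where
  "density_on_unit_interval \<pi> \<longleftrightarrow>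
     (\<forall>p\<in>{0..1}. 0 \<le> \<pi> p) \<and>
     set_integrable lborel {0..1} \<pi> \<and>
     (LINT p:{0..1}|lborel. \<pi> p) = 1"

end

theory Submission
  imports Defs "HOL-Probability.Distributions" "HOL-Real_Asymp.Real_Asymp"
begin

text \<open>
  Laplace's method. With \<open>q = k / m\<close>, the likelihood at \<open>p\<close> divided by its maximal value, attained
  at \<open>q\<close>, is \<open>exp (- m * KL(q, p))\<close> with the Kullback-Leibler divergence of Bernoulli distributions.
  After the substitution \<open>p = q + x / sqrt m\<close> it converges to a Gaussian of variance
  \<open>p_T * (1 - p_T)\<close>, and Pinsker's inequality \<open>KL(q, p) \<ge> 2 * (p - q)\<^sup>2\<close> bounds it by
  \<open>exp (- 2 * x\<^sup>2)\<close>. This gives dominated convergence near \<open>p_T\<close>, where the prior density is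
  bounded, and makes the rest of \<open>[0, 1]\<close> exponentially negligible. For the order of magnitude,
  \<open>KL(q, p_hat) \<le> (p_hat - q)\<^sup>2 / (p_hat * (1 - p_hat))\<close> shows that the maximal likelihood
  exceeds the one at \<open>p_hat\<close> by at most a constant factor, because \<open>p_hat - q = O(1 / sqrt m)\<close>.
\<close>

section \<open>Relative likelihood and bounds on the Bernoulli divergence\<close>

definition rel_likelihood :: "nat \<Rightarrow> nat \<Rightarrow> real \<Rightarrow> real" where
  "rel_likelihood m k p =
     p ^ k * (1 - p) ^ (m - k) / ((real k / real m) ^ k * (1 - real k / real m) ^ (m - k))"

definition neg_bernoulli_kl :: "real \<Rightarrow> real \<Rightarrow> real" where
  "neg_bernoulli_kl q p = q * ln (p / q) + (1 - q) * ln ((1 - p) / (1 - q))"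

text \<open>The function \<open>\<phi>\<close>, the left side minus the right, has derivative
  \<open>(q - x) * (1 / (x * (1 - x)) - 4)\<close>. Its second factor is nonnegative because x(1 -
  x) is at most 1/4, so \<open>\<phi>\<close> rises up to q, falls after q, and has its maximum
  \<open>\<phi> q = 0\<close> there.\<close>

lemma neg_bernoulli_kl_le_Pinsker:
  assumes q: "0 < q" "q < 1" and p: "0 < p" "p < 1"
  shows "neg_bernoulli_kl q p \<le> - 2 * (p - q)\<^sup>2"
proof -
  define \<phi> where "\<phi> x = neg_bernoulli_kl q x + 2 * (x - q)\<^sup>2" for x
  define \<phi>' where "\<phi>' x = (q - x) * (1 / (x * (1 - x)) - 4)" for x
  have der: "(\<phi> has_real_derivative \<phi>' x) (at x)" if "0 < x" "x < 1" for x
  proof -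
    have "(\<phi> has_real_derivative
            q / x + (q - 1) / (1 - x) + 4 * (x - q)) (at x)"
      unfolding \<phi>_def neg_bernoulli_kl_def using that q
      by (auto intro!: derivative_eq_intros)
    also have "q / x + (q - 1) / (1 - x) = (q - x) * (1 / (x * (1 - x)))"
      using that by (simp add: divide_simps) (simp add: algebra_simps)
    also have "\<dots> + 4 * (x - q) = \<phi>' x"
      by (simp add: \<phi>'_def algebra_simps)
    finally show ?thesis .
  qed
  have four: "0 \<le> 1 / (x * (1 - x)) - 4" if "0 < x" "x < 1" for x :: real
  proof -
    have "4 * (x * (1 - x)) \<le> 1"
      using zero_le_power2[of "2 * x - 1"] by (simp add: power2_eq_square algebra_simps)
    then show ?thesis using that by (simp add: field_simps)
  qed
  have "\<phi> p \<le> \<phi> q"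
  proof (cases p q rule: linorder_cases)
    case less
    obtain z where "p < z" "z < q" and z: "\<phi> q - \<phi> p = (q - p) * \<phi>' z"
      using MVT2[OF less, of \<phi> \<phi>'] der p q by force
    then have "0 \<le> \<phi>' z" unfolding \<phi>'_def using four[of z] p q by (intro mult_nonneg_nonneg) auto
    then show ?thesis using z less by (smt (verit) mult_nonneg_nonneg)
  next
    case greater
    obtain z where "q < z" "z < p" and z: "\<phi> p - \<phi> q = (p - q) * \<phi>' z"
      using MVT2[OF greater, of \<phi> \<phi>'] der p q by force
    then have "\<phi>' z \<le> 0" unfolding \<phi>'_def using four[of z] p q by (intro mult_nonpos_nonneg) auto
    then show ?thesis using z greater by (smt (verit) mult_nonneg_nonpos)
  qed simp
  also have "\<phi> q = 0" using q by (simp add: \<phi>_def neg_bernoulli_kl_def)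
  finally show ?thesis by (simp add: \<phi>_def)
qed

text \<open>Apply \<open>ln t \<le> t - 1\<close> to the two likelihood ratios q/p and (1 - q)/(1 -
  p) and average with weights q and 1 - q. The resulting upper bound on the divergence is the
  chi-square divergence of the two Bernoulli distributions.\<close>

lemma neg_bernoulli_kl_ge_chi_square:
  assumes q: "0 < q" "q < 1" and p: "0 < p" "p < 1"
  shows "- ((p - q)\<^sup>2 / (p * (1 - p))) \<le> neg_bernoulli_kl q p"
proof -
  have "ln (q / p) \<le> q / p - 1" "ln ((1 - q) / (1 - p)) \<le> (1 - q) / (1 - p) - 1"
    using p q by (auto intro!: ln_le_minus_one)
  then have "q * ln (q / p) + (1 - q) * ln ((1 - q) / (1 - p))
      \<le> q * (q / p - 1) + (1 - q) * ((1 - q) / (1 - p) - 1)"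
    using q by (intro add_mono mult_left_mono) auto
  also have "\<dots> = (p - q)\<^sup>2 / (p * (1 - p))"
    using p by (simp add: field_simps power2_eq_square)
  finally show ?thesis
    using p q by (simp add: neg_bernoulli_kl_def ln_div algebra_simps)
qed

text \<open>Multiplication by m turns the weights q and 1 - q into the exponents k and m - k. The
  strict bounds on k and p keep every logarithm away from 0.\<close>

lemma rel_likelihood_eq_exp:
  assumes k: "0 < k" "k < m" and p: "0 < p" "p < 1"
  shows "rel_likelihood m k p = exp (real m * neg_bernoulli_kl (real k / real m) p)"
proof -
  define q where "q = real k / real m"
  have q: "0 < q" "q < 1" using k by (auto simp: q_def)
  have mq: "real m * q = real k" "real m * (1 - q) = real (m - k)"
    using k by (auto simp: q_def field_simps of_nat_diff)
  have "real m * neg_bernoulli_kl q p = (real m * q) * ln (p / q) + (real m * (1 - q)) * ln ((1 - p) / (1 - q))"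
    by (simp add: neg_bernoulli_kl_def algebra_simps)
  also have "exp \<dots> = (p / q) ^ k * ((1 - p) / (1 - q)) ^ (m - k)"
    unfolding mq using p q by (simp add: exp_add exp_of_nat_mult)
  finally show ?thesis
    unfolding rel_likelihood_def q_def[symmetric] by (simp add: power_divide)
qed

lemma rel_likelihood_nonneg:
  assumes "k \<le> m" "0 \<le> p" "p \<le> 1"
  shows "0 \<le> rel_likelihood m k p"
  using assms unfolding rel_likelihood_def
  by (intro divide_nonneg_nonneg mult_nonneg_nonneg zero_le_power) (auto simp: divide_le_eq_1)

lemma rel_likelihood_le:
  assumes k: "0 < k" "k < m" and p: "0 \<le> p" "p \<le> 1"
  shows "rel_likelihood m k p \<le> exp (- 2 * real m * (p - real k / real m)\<^sup>2)"
proof (cases "0 < p \<and> p < 1")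
  case True
  have "real m * neg_bernoulli_kl (real k / real m) p \<le> real m * (- 2 * (p - real k / real m)\<^sup>2)"
    using k True by (intro mult_left_mono neg_bernoulli_kl_le_Pinsker) auto
  then show ?thesis using rel_likelihood_eq_exp[OF k, of p] True by (simp add: algebra_simps)
next
  case False
  then have "p = 0 \<or> p = 1" using p by auto
  then have "rel_likelihood m k p = 0" using k by (auto simp: rel_likelihood_def)
  then show ?thesis by simp
qed

section \<open>Pointwise Gaussian limit of the relative likelihood\<close>

lemma ln_1_plus_second_order_tendsto:
  fixes x :: "nat \<Rightarrow> real"
  assumes x: "x \<longlonglongrightarrow> 0" and c: "(\<lambda>n. c n * (x n)\<^sup>2) \<longlonglongrightarrow> L"
  shows "(\<lambda>n. c n * (ln (1 + x n) - x n)) \<longlonglongrightarrow> - L / 2"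
proof -
  \<comment> \<open>The value at 0 extends the quotient continuously. It also keeps the product
    identity below valid at indices with \<open>x n = 0\<close>.\<close>
  define h where "h t = (if t = 0 then - 1 / 2 else (ln (1 + t) - t) / t\<^sup>2)" for t :: real
  have "((\<lambda>t::real. (ln (1 + t) - t) / t\<^sup>2) \<longlongrightarrow> - 1 / 2) (at 0)"
    by real_asymp
  then have "(h \<longlongrightarrow> - 1 / 2) (at 0)"
    by (rule Lim_transform_eventually) (auto simp: h_def eventually_at_filter)
  then have "isCont h 0" by (simp add: isCont_def h_def)
  then have "(\<lambda>n. h (x n)) \<longlonglongrightarrow> - 1 / 2"
    using isCont_tendsto_compose[OF _ x, of h] by (simp add: h_def)
  then have "(\<lambda>n. (c n * (x n)\<^sup>2) * h (x n)) \<longlonglongrightarrow> L * (- 1 / 2)"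
    by (intro tendsto_mult c)
  moreover have "(c n * (x n)\<^sup>2) * h (x n) = c n * (ln (1 + x n) - x n)" for n
    by (simp add: h_def)
  ultimately show ?thesis by simp
qed

lemma eventually_interior:
  assumes q: "(\<lambda>m. real (k m) / real m) \<longlonglongrightarrow> q0" and q0: "0 < q0" "q0 < 1"
  shows "\<forall>\<^sub>F m in sequentially. 0 < k m \<and> k m < m"
  using order_tendstoD(1)[OF q q0(1)] order_tendstoD(2)[OF q q0(2)] eventually_gt_at_top[of 0]
  by eventually_elim (auto simp: divide_less_eq zero_less_divide_iff)

text \<open>Second-order expansion of the two logarithms, whose arguments are 1 + a and 1 + b. The
  linear terms cancel, and the quadratic terms add up to -x^2/(2 q0) - x^2/(2 (1 - q0)), which is
  the Gaussian exponent.\<close>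

lemma rel_likelihood_tendsto:
  assumes q: "(\<lambda>m. real (k m) / real m) \<longlonglongrightarrow> q0" and q0: "0 < q0" "q0 < 1"
  shows "(\<lambda>m. rel_likelihood m (k m) (real (k m) / real m + x / sqrt (real m)))
           \<longlonglongrightarrow> exp (- (x\<^sup>2 / (2 * (q0 * (1 - q0)))))"
proof -
  define Q where "Q m = real (k m) / real m" for m
  define a where "a m = (x / sqrt (real m)) / Q m" for m
  define b where "b m = - (x / sqrt (real m)) / (1 - Q m)" for m
  have Q: "Q \<longlonglongrightarrow> q0" using q by (simp add: Q_def [abs_def])
  have s: "(\<lambda>m. x / sqrt (real m)) \<longlonglongrightarrow> 0" by real_asymp
  have a0: "a \<longlonglongrightarrow> 0" unfolding a_def [abs_def]
    using tendsto_divide[OF s Q] q0 by simp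
  have b0: "b \<longlonglongrightarrow> 0" unfolding b_def [abs_def]
    using tendsto_divide[OF tendsto_minus[OF s] tendsto_diff[OF tendsto_const Q, of 1]] q0 by simp
  have ev: "\<forall>\<^sub>F m in sequentially. 0 < k m \<and> k m < m \<and> 0 < Q m \<and> Q m < 1"
    using eventually_interior[OF q q0] by eventually_elim (auto simp: Q_def)
  have La: "(\<lambda>m. (real m * Q m) * (ln (1 + a m) - a m)) \<longlonglongrightarrow> - (x\<^sup>2 / q0) / 2"
  proof (rule ln_1_plus_second_order_tendsto[OF a0], rule Lim_transform_eventually)
    show "(\<lambda>m. x\<^sup>2 / Q m) \<longlonglongrightarrow> x\<^sup>2 / q0" using Q q0 by (intro tendsto_intros) auto
    show "\<forall>\<^sub>F m in sequentially. x\<^sup>2 / Q m = real m * Q m * (a m)\<^sup>2"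
      using ev by eventually_elim (auto simp: a_def power_divide field_simps power2_eq_square)
  qed
  have Lb: "(\<lambda>m. (real m * (1 - Q m)) * (ln (1 + b m) - b m)) \<longlonglongrightarrow> - (x\<^sup>2 / (1 - q0)) / 2"
  proof (rule ln_1_plus_second_order_tendsto[OF b0], rule Lim_transform_eventually)
    show "(\<lambda>m. x\<^sup>2 / (1 - Q m)) \<longlonglongrightarrow> x\<^sup>2 / (1 - q0)" using Q q0 by (intro tendsto_intros) auto
    show "\<forall>\<^sub>F m in sequentially. x\<^sup>2 / (1 - Q m) = real m * (1 - Q m) * (b m)\<^sup>2"
      using ev by eventually_elim (auto simp: b_def power_divide divide_simps power2_eq_square)
  qed
  \<comment> \<open>This puts the shifted point eventually inside (0, 1), where the exponential form
    of the likelihood applies.\<close>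
  have p: "(\<lambda>m. Q m + x / sqrt (real m)) \<longlonglongrightarrow> q0" using tendsto_add[OF Q s] by simp
  have "(\<lambda>m. exp ((real m * Q m) * (ln (1 + a m) - a m) + (real m * (1 - Q m)) * (ln (1 + b m) - b m)))
      \<longlonglongrightarrow> exp (- (x\<^sup>2 / q0) / 2 + - (x\<^sup>2 / (1 - q0)) / 2)"
    by (intro tendsto_exp tendsto_add La Lb)
  also have "- (x\<^sup>2 / q0) / 2 + - (x\<^sup>2 / (1 - q0)) / 2 = - (x\<^sup>2 / (2 * (q0 * (1 - q0))))"
    using q0 by (simp add: divide_simps) (simp add: algebra_simps)
  finally show ?thesis
    unfolding Q_def[symmetric]
  proof (rule Lim_transform_eventually)
    show "\<forall>\<^sub>F m in sequentially.
       exp (real m * Q m * (ln (1 + a m) - a m) + real m * (1 - Q m) * (ln (1 + b m) - b m)) =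
       rel_likelihood m (k m) (Q m + x / sqrt (real m))"
      using ev order_tendstoD(1)[OF p q0(1)] order_tendstoD(2)[OF p q0(2)]
    proof eventually_elim
      case (elim m)
      let ?p = "Q m + x / sqrt (real m)"
      have a: "?p / Q m = 1 + a m"
        using elim by (simp add: a_def add_divide_distrib)
      have "(1 - (Q m + y)) / (1 - Q m) = 1 + - y / (1 - Q m)" for y
        using elim by (simp add: field_simps)
      then have b: "(1 - ?p) / (1 - Q m) = 1 + b m"
        by (simp only: b_def)
      \<comment> \<open>The first-order terms cancel: the likelihood is stationary at
        \<open>Q m\<close>.\<close>
      have "Q m * a m + (1 - Q m) * b m = 0" using elim by (simp add: a_def b_def)
      then have "real m * Q m * a m + real m * (1 - Q m) * b m = 0"
        by (simp only: mult.assoc distrib_left[symmetric] mult_zero_right)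
      then have "real m * Q m * (ln (1 + a m) - a m) + real m * (1 - Q m) * (ln (1 + b m) - b m)
          = real m * neg_bernoulli_kl (Q m) ?p"
        unfolding neg_bernoulli_kl_def a b by (simp add: algebra_simps)
      then show ?case
        using rel_likelihood_eq_exp[of "k m" m ?p] elim by (simp add: Q_def)
    qed
  qed
qed

section \<open>Laplace asymptotics of the likelihood integral\<close>

lemma borel_measurable_rel_likelihood [measurable]:
  "rel_likelihood m k \<in> borel_measurable borel"
  unfolding rel_likelihood_def [abs_def] by measurable

lemma gaussian_integral:
  fixes v :: real
  assumes "0 < v"
  shows "integrable lborel (\<lambda>x. exp (- (x\<^sup>2 / (2 * v))))"
    and "(LINT x|lborel. exp (- (x\<^sup>2 / (2 * v)))) = sqrt (2 * pi * v)"
proof -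
  have eq: "exp (- (x\<^sup>2 / (2 * v))) = sqrt (2 * pi * v) * normal_density 0 (sqrt v) x" for x
    using assms by (simp add: normal_density_def)
  show "integrable lborel (\<lambda>x. exp (- (x\<^sup>2 / (2 * v))))"
    unfolding eq using assms by (intro integrable_mult_right integrable_normal_density) auto
  show "(LINT x|lborel. exp (- (x\<^sup>2 / (2 * v)))) = sqrt (2 * pi * v)"
    unfolding eq using assms by simp
qed

text \<open>The substitution p = k/m + x/sqrt m absorbs the factor sqrt m. The integrands then
  converge pointwise to a Gaussian times \<open>\<psi> q0\<close>, and since \<open>\<psi>\<close>
  is bounded, Pinsker's inequality supplies a Gaussian majorant for dominated convergence.\<close>

lemma rel_likelihood_central_asymp:
  fixes \<psi> :: "real \<Rightarrow> real"
  assumes q: "(\<lambda>m. real (k m) / real m) \<longlonglongrightarrow> q0" and q0: "0 < q0" "q0 < 1"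
    and meas [measurable]: "\<psi> \<in> borel_measurable borel"
    and bound: "\<And>p. \<bar>\<psi> p\<bar> \<le> B" and supp: "\<And>p. p \<notin> {0..1} \<Longrightarrow> \<psi> p = 0"
    and cont: "isCont \<psi> q0"
  shows "(\<lambda>m. sqrt (real m) * (LINT p|lborel. rel_likelihood m (k m) p * \<psi> p))
           \<longlonglongrightarrow> sqrt (2 * pi * q0 * (1 - q0)) * \<psi> q0"
proof -
  define P where "P m x = real (k m) / real m + x / sqrt (real m)" for m x
  define F where "F m x = (if 0 < k m \<and> k m < m
      then rel_likelihood m (k m) (P m x) * \<psi> (P m x) else 0)" for m x
  have v: "0 < q0 * (1 - q0)" using q0 by simp
  have ev: "\<forall>\<^sub>F m in sequentially. 0 < k m \<and> k m < m"
    by (rule eventually_interior[OF q q0])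
  have "(\<lambda>m. LINT x|lborel. F m x) \<longlonglongrightarrow>
      (LINT x|lborel. exp (- (x\<^sup>2 / (2 * (q0 * (1 - q0))))) * \<psi> q0)"
  proof (rule integral_dominated_convergence)
    show "(\<lambda>x. exp (- (x\<^sup>2 / (2 * (q0 * (1 - q0))))) * \<psi> q0) \<in> borel_measurable lborel"
      by measurable
    show "F m \<in> borel_measurable lborel" for m
      unfolding F_def [abs_def] P_def by measurable
    \<comment> \<open>The Pinsker bound \<open>exp (- 2 * x\<^sup>2)\<close>, written as a Gaussian of variance \<open>1 / 4\<close>.\<close>
    show "integrable lborel (\<lambda>x. exp (- (x\<^sup>2 / (2 * (1 / 4)))) * B)"
      by (intro integrable_mult_left gaussian_integral) auto
    have "norm (F m x) \<le> exp (- (x\<^sup>2 / (2 * (1 / 4)))) * B" for m x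
    proof (cases "0 < k m \<and> k m < m \<and> P m x \<in> {0..1}")
      case True
      then have "rel_likelihood m (k m) (P m x) \<le> exp (- 2 * real m * (x / sqrt (real m))\<^sup>2)"
        using rel_likelihood_le[of "k m" m "P m x"] by (simp add: P_def)
      also have "real m * (x / sqrt (real m))\<^sup>2 = x\<^sup>2"
        using True by (simp add: power_divide)
      then have "- 2 * real m * (x / sqrt (real m))\<^sup>2 = - (x\<^sup>2 / (2 * (1 / 4)))"
        by simp
      finally have "rel_likelihood m (k m) (P m x) * \<bar>\<psi> (P m x)\<bar> \<le> exp (- (x\<^sup>2 / (2 * (1 / 4)))) * B"
        by (intro mult_mono bound) auto
      then show ?thesis
        using True rel_likelihood_nonneg[of "k m" m "P m x"] by (simp add: F_def abs_mult)
    next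
      case False
      then have "F m x = 0" using supp[of "P m x"] by (auto simp: F_def)
      moreover have "0 \<le> B" using bound[of 0] by linarith
      ultimately show ?thesis by simp
    qed
    then show "AE x in lborel. norm (F m x) \<le> exp (- (x\<^sup>2 / (2 * (1 / 4)))) * B" for m by simp
    have "(\<lambda>m. F m x) \<longlonglongrightarrow> exp (- (x\<^sup>2 / (2 * (q0 * (1 - q0))))) * \<psi> q0" for x
    proof (rule Lim_transform_eventually)
      have "(\<lambda>m. x / sqrt (real m)) \<longlonglongrightarrow> 0" by real_asymp
      then have "(\<lambda>m. P m x) \<longlonglongrightarrow> q0" unfolding P_def using tendsto_add[OF q] by fastforce
      then show "(\<lambda>m. rel_likelihood m (k m) (P m x) * \<psi> (P m x))
          \<longlonglongrightarrow> exp (- (x\<^sup>2 / (2 * (q0 * (1 - q0))))) * \<psi> q0"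
        using rel_likelihood_tendsto[OF q q0, of x] cont
        by (intro tendsto_mult isCont_tendsto_compose[of _ \<psi>]) (simp_all add: P_def)
      show "\<forall>\<^sub>F m in sequentially. rel_likelihood m (k m) (P m x) * \<psi> (P m x) = F m x"
        using ev by eventually_elim (simp add: F_def)
    qed
    then show "AE x in lborel. (\<lambda>m. F m x) \<longlonglongrightarrow> exp (- (x\<^sup>2 / (2 * (q0 * (1 - q0))))) * \<psi> q0"
      by simp
  qed
  also have "(LINT x|lborel. exp (- (x\<^sup>2 / (2 * (q0 * (1 - q0))))) * \<psi> q0)
      = sqrt (2 * pi * q0 * (1 - q0)) * \<psi> q0"
    using gaussian_integral[OF v] by (simp add: mult.assoc)
  finally show ?thesis
  proof (rule Lim_transform_eventually)
    show "\<forall>\<^sub>F m in sequentially. (LINT x|lborel. F m x) =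
        sqrt (real m) * (LINT p|lborel. rel_likelihood m (k m) p * \<psi> p)"
      using ev
    proof eventually_elim
      case (elim m)
      then have m: "sqrt (real m) > 0" by simp
      \<comment> \<open>Affine change of variables with Jacobian
        \<open>1 / sqrt (real m)\<close>.\<close>
      have "(LINT p|lborel. rel_likelihood m (k m) p * \<psi> p)
          = (1 / sqrt (real m)) * (LINT x|lborel. F m x)"
        using m elim by (subst lborel_integral_real_affine[of "1 / sqrt (real m)" _ "real (k m) / real m"])
          (auto simp: F_def [abs_def] P_def)
      then show ?case using m by simp
    qed
  qed
qed

text \<open>Once k/m is within c/2 of q0, every p in the support of \<open>\<psi>\<close> is at
  distance at least c/2 from k/m. Pinsker's inequality then gives the factor exp(-c^2 m/2), which
  beats sqrt m. What remains is the L1 norm of \<open>\<psi>\<close>, so densities unbounded near 0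
  or 1 are covered.\<close>

lemma rel_likelihood_tail_asymp:
  fixes \<psi> :: "real \<Rightarrow> real"
  assumes q: "(\<lambda>m. real (k m) / real m) \<longlonglongrightarrow> q0" and q0: "0 < q0" "q0 < 1"
    and int: "integrable lborel \<psi>" and c: "0 < c"
    and supp: "\<And>p. p \<notin> {0..1} \<or> \<bar>p - q0\<bar> \<le> c \<Longrightarrow> \<psi> p = 0"
  shows "(\<lambda>m. sqrt (real m) * (LINT p|lborel. rel_likelihood m (k m) p * \<psi> p)) \<longlonglongrightarrow> 0"
proof (rule Lim_null_comparison)
  have "(\<lambda>m. sqrt (real m) * exp (- (c\<^sup>2 / 2 * real m))) \<longlonglongrightarrow> 0"
    using c by real_asymp
  then show "(\<lambda>m. sqrt (real m) * exp (- (c\<^sup>2 / 2 * real m)) * (LINT p|lborel. \<bar>\<psi> p\<bar>)) \<longlonglongrightarrow> 0"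
    by (rule tendsto_mult_left_zero)
  have "\<forall>\<^sub>F m in sequentially. \<bar>real (k m) / real m - q0\<bar> < c / 2"
    using tendstoD[OF q, of "c / 2"] c by (simp add: dist_real_def)
  then show "\<forall>\<^sub>F m in sequentially.
      norm (sqrt (real m) * (LINT p|lborel. rel_likelihood m (k m) p * \<psi> p))
      \<le> sqrt (real m) * exp (- (c\<^sup>2 / 2 * real m)) * (LINT p|lborel. \<bar>\<psi> p\<bar>)"
    using eventually_interior[OF q q0]
  proof eventually_elim
    case (elim m)
    have le: "\<bar>rel_likelihood m (k m) p * \<psi> p\<bar> \<le> exp (- (c\<^sup>2 / 2 * real m)) * \<bar>\<psi> p\<bar>" for p
    proof (cases "\<psi> p = 0")
      case False
      then have p: "p \<in> {0..1}" "c < \<bar>p - q0\<bar>" using supp[of p] by force+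
      have "(c / 2)\<^sup>2 \<le> (p - real (k m) / real m)\<^sup>2"
        using p elim c by (subst abs_le_square_iff[symmetric]) linarith
      then have "real m * (c / 2)\<^sup>2 \<le> real m * (p - real (k m) / real m)\<^sup>2"
        by (intro mult_left_mono) auto
      then have "exp (- 2 * real m * (p - real (k m) / real m)\<^sup>2) \<le> exp (- (c\<^sup>2 / 2 * real m))"
        by (simp add: power_divide mult.commute mult.left_commute)
      moreover have "rel_likelihood m (k m) p \<le> exp (- 2 * real m * (p - real (k m) / real m)\<^sup>2)"
        using p elim by (intro rel_likelihood_le) auto
      ultimately have "rel_likelihood m (k m) p \<le> exp (- (c\<^sup>2 / 2 * real m))"
        by (rule order_trans[rotated])
      then show ?thesis
        using rel_likelihood_nonneg[of "k m" m p] p elim by (simp add: abs_mult mult_right_mono)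
    qed simp
    have "norm (LINT p|lborel. rel_likelihood m (k m) p * \<psi> p)
        \<le> (LINT p|lborel. norm (rel_likelihood m (k m) p * \<psi> p))"
      by (rule integral_norm_bound)
    also have "\<dots> \<le> (LINT p|lborel. exp (- (c\<^sup>2 / 2 * real m)) * \<bar>\<psi> p\<bar>)"
      using int le by (intro integral_mono' integrable_mult_right integrable_abs) auto
    finally have "\<bar>LINT p|lborel. rel_likelihood m (k m) p * \<psi> p\<bar>
        \<le> exp (- (c\<^sup>2 / 2 * real m)) * (LINT p|lborel. \<bar>\<psi> p\<bar>)"
      by simp
    then show ?case
      by (simp add: abs_mult mult.assoc mult_left_mono)
  qed
qed

text \<open>Split the density at a small interval around q0: on it, continuity makes the density
  bounded and the central asymptotics apply; off it, the tail estimate does.\<close>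

lemma rel_likelihood_integral_asymp:
  fixes \<pi> :: "real \<Rightarrow> real"
  assumes q: "(\<lambda>m. real (k m) / real m) \<longlonglongrightarrow> q0" and q0: "0 < q0" "q0 < 1"
    and int: "set_integrable lborel {0..1} \<pi>" and cont: "isCont \<pi> q0"
  shows "(\<lambda>m. sqrt (real m) * (LINT p:{0..1}|lborel. rel_likelihood m (k m) p * \<pi> p))
           \<longlonglongrightarrow> sqrt (2 * pi * q0 * (1 - q0)) * \<pi> q0"
proof -
  \<comment> \<open>Extension by zero, since \<open>\<pi>\<close> is arbitrary outside [0, 1]. It
    agrees with \<open>\<pi>\<close> near the interior point q0, so continuity there carries
    over.\<close>
  define \<rho> where "\<rho> p = indicator {0..1} p * \<pi> p" for p
  have \<rho>: "integrable lborel \<rho>" using int by (simp add: set_integrable_def \<rho>_def [abs_def])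
  have near: "\<forall>\<^sub>F p in nhds q0. \<rho> p = \<pi> p"
    using eventually_nhds_in_open[of "{0<..<1}" q0] q0
    by (auto elim!: eventually_mono simp: \<rho>_def)
  have cont': "isCont \<rho> q0" using cont isCont_cong[OF near] by simp
  have "\<forall>\<^sub>F p in nhds q0. \<bar>\<rho> p\<bar> \<le> \<bar>\<rho> q0\<bar> + 1"
  proof -
    have "(\<rho> \<longlongrightarrow> \<rho> q0) (nhds q0)" using cont' by (simp add: tendsto_nhds_iff isCont_def)
    from tendstoD[OF this, of 1] show ?thesis
      by (auto elim!: eventually_mono simp: dist_real_def)
  qed
  then obtain d where d: "0 < d" "\<And>p. \<bar>p - q0\<bar> < d \<Longrightarrow> \<bar>\<rho> p\<bar> \<le> \<bar>\<rho> q0\<bar> + 1"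
    by (auto simp: eventually_nhds_metric dist_real_def)
  \<comment> \<open>Halving keeps the closed interval \<open>S\<close> inside the open ball of
    radius d on which \<open>\<rho>\<close> is bounded.\<close>
  define c where "c = d / 2"
  define S where "S = {q0 - c..q0 + c}"
  have c: "0 < c" "c < d" using d by (auto simp: c_def)
  have [measurable]: "\<rho> \<in> borel_measurable borel" "S \<in> sets borel"
    using borel_measurable_integrable[OF \<rho>] by (auto simp: S_def)
  have ic: "integrable lborel (\<lambda>p. indicator S p * \<rho> p)"
    and it: "integrable lborel (\<lambda>p. indicator (- S) p * \<rho> p)"
    using \<rho> by (auto intro!: integrable_real_mult_indicator[where f = \<rho>, simplified mult.commute]
         Bochner_Integration.integrable_bound[OF \<rho>] simp: indicator_def)
  have "\<forall>\<^sub>F p in nhds q0. indicator S p * \<rho> p = \<rho> p"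
    using eventually_nhds_in_open[of "{q0 - c<..<q0 + c}" q0] c
    by (auto elim!: eventually_mono simp: S_def)
  from isCont_cong[OF this] have contS: "isCont (\<lambda>p. indicator S p * \<rho> p) q0" using cont' by simp
  have central: "(\<lambda>m. sqrt (real m) * (LINT p|lborel. rel_likelihood m (k m) p * (indicator S p * \<rho> p)))
      \<longlonglongrightarrow> sqrt (2 * pi * q0 * (1 - q0)) * (indicator S q0 * \<rho> q0)"
  proof (rule rel_likelihood_central_asymp[OF q q0 _ _ _ contS])
    show "(\<lambda>p. indicator S p * \<rho> p) \<in> borel_measurable borel" by measurable
    show "\<bar>indicator S p * \<rho> p\<bar> \<le> \<bar>\<rho> q0\<bar> + 1" for p
      using d(2)[of p] c by (auto simp: S_def indicator_def abs_le_iff)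
  qed (auto simp: \<rho>_def)
  have tail: "(\<lambda>m. sqrt (real m) * (LINT p|lborel. rel_likelihood m (k m) p * (indicator (- S) p * \<rho> p)))
      \<longlonglongrightarrow> 0"
    by (rule rel_likelihood_tail_asymp[OF q q0 it c(1)]) (auto simp: S_def \<rho>_def indicator_def)
  have "indicator S q0 * \<rho> q0 = \<pi> q0"
    using q0 c by (simp add: S_def \<rho>_def)
  with tendsto_add[OF central tail] have
    "(\<lambda>m. sqrt (real m) * (LINT p|lborel. rel_likelihood m (k m) p * (indicator S p * \<rho> p)) +
        sqrt (real m) * (LINT p|lborel. rel_likelihood m (k m) p * (indicator (- S) p * \<rho> p)))
      \<longlonglongrightarrow> sqrt (2 * pi * q0 * (1 - q0)) * \<pi> q0"
    by (simp only: add_0_right)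
  then show ?thesis
  proof (rule Lim_transform_eventually)
    show "\<forall>\<^sub>F m in sequentially.
        sqrt (real m) * (LINT p|lborel. rel_likelihood m (k m) p * (indicator S p * \<rho> p)) +
        sqrt (real m) * (LINT p|lborel. rel_likelihood m (k m) p * (indicator (- S) p * \<rho> p)) =
        sqrt (real m) * (LINT p:{0..1}|lborel. rel_likelihood m (k m) p * \<pi> p)"
      using eventually_interior[OF q q0]
    proof eventually_elim
      case (elim m)
      \<comment> \<open>The bound by 1 makes the likelihood times an integrable function integrable,
        as additivity of the integral over the two pieces requires.\<close>
      have r1: "\<bar>rel_likelihood m (k m) p\<bar> \<le> 1" if "p \<in> {0..1}" for p
        using rel_likelihood_le[of "k m" m p] rel_likelihood_nonneg[of "k m" m p] elim that
        by (auto intro: order_trans)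
      have int_lik: "integrable lborel (\<lambda>p. rel_likelihood m (k m) p * \<phi> p)"
        if "integrable lborel \<phi>" "\<And>p. p \<notin> {0..1} \<Longrightarrow> \<phi> p = 0" for \<phi> :: "real \<Rightarrow> real"
      proof (rule Bochner_Integration.integrable_bound[OF that(1)])
        show "(\<lambda>p. rel_likelihood m (k m) p * \<phi> p) \<in> borel_measurable lborel"
          using borel_measurable_integrable[OF that(1)] by measurable
        have "norm (rel_likelihood m (k m) p * \<phi> p) \<le> norm (\<phi> p)" for p
          using r1[of p] that(2)[of p] by (cases "p \<in> {0..1}") (auto simp: abs_mult intro: mult_left_le_one_le)
        then show "AE p in lborel. norm (rel_likelihood m (k m) p * \<phi> p) \<le> norm (\<phi> p)" by simp
      qed
      have "(LINT p|lborel. rel_likelihood m (k m) p * (indicator S p * \<rho> p))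
          + (LINT p|lborel. rel_likelihood m (k m) p * (indicator (- S) p * \<rho> p))
          = (LINT p|lborel. rel_likelihood m (k m) p * (indicator S p * \<rho> p)
              + rel_likelihood m (k m) p * (indicator (- S) p * \<rho> p))"
        by (intro Bochner_Integration.integral_add[symmetric] int_lik ic it) (auto simp: \<rho>_def)
      also have "\<dots> = (LINT p:{0..1}|lborel. rel_likelihood m (k m) p * \<pi> p)"
        unfolding set_lebesgue_integral_def
        by (intro Bochner_Integration.integral_cong) (auto simp: \<rho>_def indicator_def)
      finally show ?case by (simp add: distrib_left [symmetric])
    qed
  qed
qed

section \<open>The ratio of the fully Bayes and empirical-Bayes priors\<close>

theorem theorem5p5:
  fixes p_T :: real
    and \<pi> :: "real \<Rightarrow> real"
    and k_T :: "nat \<Rightarrow> nat"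
    and \<gamma> :: "nat \<Rightarrow> nat \<Rightarrow> nat"
    and k :: "nat \<Rightarrow> nat"
    and p_hat :: "nat \<Rightarrow> real"
    and \<epsilon>_E :: "nat \<Rightarrow> real"
  assumes "0 < p_T" and "p_T < 1"
    and "density_on_unit_interval \<pi>"
    and "continuous_on {0<..<1} \<pi>"
    and "\<forall>p\<in>{0<..<1}. \<pi> p \<noteq> 0"
    and "\<forall>m. k_T m \<le> m"
    and "(\<lambda>m. real (k_T m) / real m - p_T) \<in> O(\<lambda>m. 1 / sqrt (real m))"
    and "\<forall>m. \<gamma> m \<in> models m"
    and "\<forall>m. k m = model_size m (\<gamma> m)"
    and "(\<lambda>m. real (k_T m) - real (k m)) \<in> O(\<lambda>m. sqrt (real m))"
    and "\<forall>m. 0 \<le> p_hat m \<and> p_hat m \<le> 1"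
    and "\<forall>m. p_hat m = p_T * (1 + \<epsilon>_E m)"
    and "\<epsilon>_E \<in> O(\<lambda>m. 1 / sqrt (real m))"
  shows "(\<exists>\<delta> \<in> o(\<lambda>m. 1 :: real). \<forall>\<^sub>F m in sequentially.
            fully_bayes_prior \<pi> m (\<gamma> m) / emp_bayes_prior (p_hat m) m (\<gamma> m) =
              ((real (k m) / real m) ^ k m * (1 - real (k m) / real m) ^ (m - k m)
                * sqrt (2 * pi * (real (k m) / real m) * (1 - real (k m) / real m))
                * \<pi> (real (k m) / real m) * real m powr (- 1 / 2) * (1 + \<delta> m))
              / (p_hat m ^ k m * (1 - p_hat m) ^ (m - k m)))
         \<and> (\<lambda>m. fully_bayes_prior \<pi> m (\<gamma> m) / emp_bayes_prior (p_hat m) m (\<gamma> m))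
             \<in> O(\<lambda>m. 1 / sqrt (real m))"
proof -
  define Q where "Q m = real (k m) / real m" for m
  define I where "I m = (LINT p:{0..1}|lborel. rel_likelihood m (k m) p * \<pi> p)" for m
  define A where "A m = sqrt (2 * pi * Q m * (1 - Q m)) * \<pi> (Q m)" for m
  \<comment> \<open>The claimed identity solved for the error term: it amounts to
    \<open>A m * (1 + \<delta> m) = sqrt (real m) * I m\<close>. Values where \<open>A m\<close> or
    m is 0 do not matter, because the identity is claimed only eventually.\<close>
  define \<delta> where "\<delta> m = sqrt (real m) * I m / A m - 1" for m
  let ?r = "\<lambda>m. fully_bayes_prior \<pi> m (\<gamma> m) / emp_bayes_prior (p_hat m) m (\<gamma> m)"
  note pT = \<open>0 < p_T\<close> \<open>p_T < 1\<close>
  have "(\<lambda>m. (real (k_T m) - real (k m)) / real m) \<in> O(\<lambda>m. sqrt (real m) / real m)"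
    using \<open>(\<lambda>m. real (k_T m) - real (k m)) \<in> O(\<lambda>m. sqrt (real m))\<close>
    by (intro landau_o.big.divide_right) (auto simp: eventually_at_top_linorder intro: exI[of _ 1])
  moreover have "sqrt (real m) / real m = 1 / sqrt (real m)" for m
    by (simp add: sqrt_divide_self_eq inverse_eq_divide)
  ultimately have "(\<lambda>m. (real (k_T m) - real (k m)) / real m) \<in> O(\<lambda>m. 1 / sqrt (real m))"
    by simp
  \<comment> \<open>Q - p_T is the difference of k_T/m - p_T and (k_T - k)/m.\<close>
  from sum_in_bigo(2)[OF \<open>(\<lambda>m. real (k_T m) / real m - p_T) \<in> _\<close> this]
  have QO: "(\<lambda>m. Q m - p_T) \<in> O(\<lambda>m. 1 / sqrt (real m))"
    by (simp add: Q_def diff_divide_distrib algebra_simps)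
  have pO: "(\<lambda>m. p_hat m - p_T) \<in> O(\<lambda>m. 1 / sqrt (real m))"
    using pT \<open>\<epsilon>_E \<in> _\<close> \<open>\<forall>m. p_hat m = p_T * (1 + \<epsilon>_E m)\<close> by (simp add: algebra_simps)
  have tendsto_pT: "f \<longlonglongrightarrow> p_T" if "(\<lambda>m. f m - p_T) \<in> O(\<lambda>m. 1 / sqrt (real m))" for f
  proof -
    have "(\<lambda>m. f m - p_T) \<in> o(\<lambda>m. 1)"
      by (rule landau_o.big_small_trans[OF that]) real_asymp
    from smalloD_tendsto[OF this] show ?thesis by (simp add: LIM_zero_iff)
  qed
  have Q: "Q \<longlonglongrightarrow> p_T" and p: "p_hat \<longlonglongrightarrow> p_T" by (intro tendsto_pT QO pO)+
  have Q': "(\<lambda>m. real (k m) / real m) \<longlonglongrightarrow> p_T" using Q by (simp add: Q_def [abs_def])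
  have cont: "isCont \<pi> p_T"
    using \<open>continuous_on {0<..<1} \<pi>\<close> pT by (simp add: continuous_on_eq_continuous_at)
  have \<pi>0: "\<pi> p_T \<noteq> 0" using assms(5) pT by simp
  have int: "set_integrable lborel {0..1} \<pi>"
    using \<open>density_on_unit_interval \<pi>\<close> by (simp add: density_on_unit_interval_def)
  have I: "(\<lambda>m. sqrt (real m) * I m) \<longlonglongrightarrow> sqrt (2 * pi * p_T * (1 - p_T)) * \<pi> p_T"
    unfolding I_def by (rule rel_likelihood_integral_asymp[OF Q' pT int cont])
  have A: "A \<longlonglongrightarrow> sqrt (2 * pi * p_T * (1 - p_T)) * \<pi> p_T"
    unfolding A_def [abs_def] by (intro tendsto_intros Q isCont_tendsto_compose[OF cont Q])
  \<comment> \<open>Numerator and denominator have the same limit, which is nonzero because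
    \<open>\<pi> p_T\<close> is.\<close>
  have "\<delta> \<longlonglongrightarrow> 1 - 1"
    unfolding \<delta>_def [abs_def]
    using tendsto_diff[OF tendsto_divide[OF I A] tendsto_const, of 1] pT \<pi>0 by simp
  then have \<delta>: "\<delta> \<in> o(\<lambda>m. 1)" by (intro smalloI_tendsto) auto
  have k_int: "\<forall>\<^sub>F m in sequentially. 0 < k m \<and> k m < m"
    by (rule eventually_interior[OF Q' pT])
  have k: "k m = model_size m (\<gamma> m)" for m
    using \<open>\<forall>m. k m = model_size m (\<gamma> m)\<close> by blast
  \<comment> \<open>The maximal likelihood does not depend on p and comes out of the integral; it is
    nonzero for k strictly between 0 and m.\<close>
  have FB: "\<forall>\<^sub>F m in sequentially. fully_bayes_prior \<pi> m (\<gamma> m) = Q m ^ k m * (1 - Q m) ^ (m - k m) * I m"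
    using k_int
  proof eventually_elim
    case (elim m)
    then have *: "Q m \<noteq> 0" "Q m \<noteq> 1" by (auto simp: Q_def)
    have "prior_given m x (\<gamma> m) = Q m ^ k m * (1 - Q m) ^ (m - k m) * rel_likelihood m (k m) x" for x
      using * unfolding prior_given_def rel_likelihood_def Q_def[symmetric] k [symmetric] by simp
    then show ?case
      by (simp add: fully_bayes_prior_def I_def mult.assoc)
  qed
  have EB: "emp_bayes_prior (p_hat m) m (\<gamma> m) = p_hat m ^ k m * (1 - p_hat m) ^ (m - k m)" for m
    by (simp add: emp_bayes_prior_def prior_given_def k)
  have "\<forall>\<^sub>F m in sequentially. A m \<noteq> 0"
    using tendsto_imp_eventually_ne[OF A] pT \<pi>0 by simp
  then have "\<forall>\<^sub>F m in sequentially. ?r m =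
      (Q m ^ k m * (1 - Q m) ^ (m - k m) * sqrt (2 * pi * Q m * (1 - Q m)) * \<pi> (Q m)
        * real m powr (- 1 / 2) * (1 + \<delta> m)) / (p_hat m ^ k m * (1 - p_hat m) ^ (m - k m))"
    using FB k_int
  proof eventually_elim
    case (elim m)
    have "real m powr (- 1 / 2) = 1 / sqrt (real m)"
      using elim by (simp add: powr_minus_divide powr_half_sqrt)
    then have "A m * real m powr (- 1 / 2) * (1 + \<delta> m) = I m"
      using elim by (simp add: \<delta>_def)
    then show ?case
      unfolding EB using elim(2) by (simp add: A_def mult.assoc)
  qed
  \<comment> \<open>The ratio equals \<open>I m\<close> divided by the relative likelihood at
    \<open>p_hat m\<close>. The integral is of order 1/sqrt m by its asymptotics, so it remains to
    bound the relative likelihood at \<open>p_hat m\<close> away from 0.\<close>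
  moreover have "?r \<in> O(\<lambda>m. 1 / sqrt (real m))"
  proof -
    have "(\<lambda>m. Q m - p_hat m) \<in> O(\<lambda>m. 1 / sqrt (real m))"
      using sum_in_bigo(2)[OF QO pO] by simp
    then obtain C where C: "0 < C" "\<forall>\<^sub>F m in sequentially. \<bar>Q m - p_hat m\<bar> \<le> C * (1 / sqrt (real m))"
      by (auto elim!: landau_o.bigE)
    \<comment> \<open>Half the limit of \<open>p_hat m * (1 - p_hat m)\<close>, hence eventually a
      positive lower bound for the denominator of the chi-square bound.\<close>
    define v where "v = p_T * (1 - p_T) / 2"
    have v: "0 < v" "v < p_T * (1 - p_T)" using pT by (auto simp: v_def)
    have "(\<lambda>m. p_hat m * (1 - p_hat m)) \<longlonglongrightarrow> p_T * (1 - p_T)" by (intro tendsto_intros p)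
    from order_tendstoD(1)[OF this v(2)]
    have "\<forall>\<^sub>F m in sequentially. norm (1 / rel_likelihood m (k m) (p_hat m)) \<le> exp (C\<^sup>2 / v) * norm (1 :: real)"
      using C(2) k_int order_tendstoD(1)[OF p pT(1)] order_tendstoD(2)[OF p pT(2)]
    proof eventually_elim
      case (elim m)
      then have "(p_hat m - Q m)\<^sup>2 \<le> (C * (1 / sqrt (real m)))\<^sup>2"
        using C(1) by (subst abs_le_square_iff[symmetric]) (simp add: abs_minus_commute)
      \<comment> \<open>The rate 1/sqrt m is exactly what cancels the factor m in the
        exponent.\<close>
      then have "real m * (p_hat m - Q m)\<^sup>2 \<le> C\<^sup>2"
        using elim by (simp add: power_mult_distrib power_divide field_simps)
      then have "real m * (p_hat m - Q m)\<^sup>2 / (p_hat m * (1 - p_hat m)) \<le> C\<^sup>2 / v"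
        using elim v by (intro frac_le) auto
      moreover have "real m * - ((p_hat m - Q m)\<^sup>2 / (p_hat m * (1 - p_hat m)))
          \<le> real m * neg_bernoulli_kl (Q m) (p_hat m)"
        using elim by (intro mult_left_mono neg_bernoulli_kl_ge_chi_square) (auto simp: Q_def)
      ultimately have "- (C\<^sup>2 / v) \<le> real m * neg_bernoulli_kl (Q m) (p_hat m)"
        by simp
      then show ?case
        using rel_likelihood_eq_exp[of "k m" m "p_hat m"] elim
        by (simp add: Q_def exp_minus [symmetric] inverse_eq_divide [symmetric])
    qed
    then have "(\<lambda>m. 1 / rel_likelihood m (k m) (p_hat m)) \<in> O(\<lambda>m. 1)"
      by (rule landau_o.bigI[rotated]) simp
    moreover have "(\<lambda>m. sqrt (real m) * I m) \<in> O(\<lambda>m. 1)"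
      by (rule bigoI_tendsto[where c = "sqrt (2 * pi * p_T * (1 - p_T)) * \<pi> p_T"]) (use I in auto)
    ultimately have "(\<lambda>m. (1 / sqrt (real m)) * ((sqrt (real m) * I m) * (1 / rel_likelihood m (k m) (p_hat m))))
        \<in> O(\<lambda>m. (1 / sqrt (real m)) * (1 * 1))"
      by (intro landau_o.big.mult landau_o.big_refl)
    \<comment> \<open>The maximal likelihood in the fully Bayes prior is the denominator of the
      relative likelihood, so the quotient is the ratio of the two priors.\<close>
    moreover have "\<forall>\<^sub>F m in sequentially.
        (1 / sqrt (real m)) * ((sqrt (real m) * I m) * (1 / rel_likelihood m (k m) (p_hat m))) = ?r m"
      using FB k_int
    proof eventually_elim
      case (elim m)
      then show ?case unfolding EB elim(1) by (simp add: rel_likelihood_def Q_def)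
    qed
    ultimately show ?thesis using landau_o.big.in_cong by fastforce
  qed
  ultimately show ?thesis using \<delta> unfolding Q_def by blast
qed

end
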